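(* Let $\mu^{(0)}=\frac12(\Delta_{-1}+\Delta_{1})$, where $\Delta_a$ is the unit point mass at $a$. Let $0<\delta<1$, let $\mu^{(1)}$ be the invariant measure of the affine homogeneous iterated function system with contraction ratio $\delta$ and distribution of fixed points $\mu^{(0)}$, and let $\mu^{(2)}$ be the invariant measure of the affine homogeneous iterated function system with the same contraction ratio $\delta$ and distribution of fixed points $\mu^{(1)}$. If $\delta=\frac25$, then $\mu^{(2)}$ is absolutely continuous with respect to Lebesgue measure with a continuous density. If $\delta=\frac{3}{10}$, then $\mu^{(2)}$ is absolutely continuous with respect to Lebesgue measure with an $L^2$ density.
   Context: Let $0<\delta<1$, $\bar\delta:=1-\delta$, and let $\sigma$ be a Borel probability measure on $[-1,1]$. The affine homogeneous iterated function system with contraction ratio $\delta$ and distribution of fixed points $\sigma$ is the family of maps $\phi_{\delta,\beta}(x)=\delta(x-\beta)+\beta=\delta x+\bar\delta\beta$ of $[-1,1]$ into itself, with $\beta$ chosen at random with law $\sigma$. Its transfer operator on continuous functions on $[-1,1]$ is $(Tf)(x)=\int f(\delta x+\bar\delta\beta)\,d\sigma(\beta)$, and $T^*$ is the adjoint acting on Borel measures, $\int f\,d(T^*\mu)=\int Tf\,d\mu$. The invariant measure is the unique Borel probability measure $\mu$ on $[-1,1]$ with $T^*\mu=\mu$ (existence and uniqueness are known). *)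

theory Defs
  imports "HOL-Probability.Probability"
begin

(* A Borel probability measure on [-1,1] is encoded as a Borel probability measure on the
   real line that gives full mass to [-1,1]. *)
definition prob_on_interval :: "real measure \<Rightarrow> bool" where
  "prob_on_interval \<sigma> \<longleftrightarrow>
     prob_space \<sigma> \<and> sets \<sigma> = sets borel \<and> emeasure \<sigma> {-1..1} = 1"

definition ifs_map :: "real \<Rightarrow> real \<Rightarrow> real \<Rightarrow> real" where
  "ifs_map \<delta> \<beta> x = \<delta> * (x - \<beta>) + \<beta>"

lemma ifs_map_eq: "ifs_map \<delta> \<beta> x = \<delta> * x + (1 - \<delta>) * \<beta>"
  by (simp add: ifs_map_def algebra_simps)

(* Integrals are explicitly restricted to [-1,1], because a function that is merely continuous
   on [-1,1] can be non-measurable outside, where the Bochner integral over the whole line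
   would default to 0. *)
definition transfer :: "real \<Rightarrow> real measure \<Rightarrow> (real \<Rightarrow> real) \<Rightarrow> real \<Rightarrow> real" where
  "transfer \<delta> \<sigma> f x = (LINT \<beta>:{-1..1}|\<sigma>. f (ifs_map \<delta> \<beta> x))"

(* The graph of the adjoint T* of the transfer operator: nu = T* mu. *)
definition transfer_adjoint ::
    "real \<Rightarrow> real measure \<Rightarrow> real measure \<Rightarrow> real measure \<Rightarrow> bool" where
  "transfer_adjoint \<delta> \<sigma> \<mu> \<nu> \<longleftrightarrow>
     (\<forall>f. continuous_on {-1..1} f \<longrightarrow>
        (LINT x:{-1..1}|\<nu>. f x) = (LINT x:{-1..1}|\<mu>. transfer \<delta> \<sigma> f x))"

definition invariant_measure :: "real \<Rightarrow> real measure \<Rightarrow> real measure \<Rightarrow> bool" where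
  "invariant_measure \<delta> \<sigma> \<mu> \<longleftrightarrow> prob_on_interval \<mu> \<and> transfer_adjoint \<delta> \<sigma> \<mu> \<mu>"

definition mu0 :: "real measure" where
  "mu0 = measure_of UNIV (sets borel)
           (\<lambda>A. (emeasure (return borel (-1)) A + emeasure (return borel 1) A) / 2)"

lemma sets_mu0 [simp]: "sets mu0 = sets borel"
  unfolding mu0_def by (metis sets.sigma_sets_eq sets_measure_of space_borel subset_UNIV Pow_UNIV)

lemma emeasure_mu0:
  assumes "A \<in> sets borel"
  shows "emeasure mu0 A = (indicator A (-1) + indicator A 1) / 2"
proof -
  let ?m = "\<lambda>A. (emeasure (return borel (-1::real)) A + emeasure (return borel 1) A) / 2"
  have "countably_additive (sets borel) ?m"
  proof (rule countably_additiveI)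
    fix F :: "nat \<Rightarrow> real set"
    assume F: "range F \<subseteq> sets borel" "disjoint_family F"
    have 1: "(\<Sum>i. emeasure (return borel a) (F i)) = emeasure (return borel a) (\<Union>i. F i)"
      for a :: real using F by (intro suminf_emeasure) auto
    show "(\<Sum>i. ?m (F i)) = ?m (\<Union>i. F i)"
      by (simp add: divide_ennreal_def ennreal_suminf_multc suminf_add [symmetric] 1
            del: emeasure_return)
  qed
  moreover have "positive (sets borel) ?m"
    by (simp add: positive_def)
  moreover have "sigma_algebra (UNIV :: real set) (sets borel)"
    using sets.sigma_algebra_axioms [of borel] by simp
  ultimately have "emeasure mu0 A = ?m A"
    unfolding mu0_def using assms by (intro emeasure_measure_of_sigma) auto
  then show ?thesis using assms by simp
qed

lemma prob_on_interval_mu0: "prob_on_interval mu0"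
proof -
  have two: "(1 + 1) / 2 = (1::ennreal)"
    by (simp only: one_add_one) (rule ennreal_divide_self; simp)
  have "space mu0 = UNIV" using sets_eq_imp_space_eq [OF sets_mu0] by simp
  then show ?thesis
    by (auto simp: prob_on_interval_def emeasure_mu0 two intro!: prob_spaceI)
qed

end

theory Submission
  imports Defs
begin

text \<open>
  Invariance of \<open>\<mu>\<close> under the system with fixed-point law \<open>\<sigma>\<close> says that \<open>\<mu>\<close> is the law of
  \<open>\<delta> X + (1 - \<delta>) \<beta>\<close> with \<open>X\<close> and \<open>\<beta>\<close> independent of laws \<open>\<mu>\<close> and \<open>\<sigma>\<close>, so characteristic functions
  satisfy \<open>char \<mu> t = char \<sigma> ((1 - \<delta>) t) * char \<mu> (\<delta> t)\<close> (lemma \<open>char_invariant_measure\<close>). This is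
  used twice.

  For \<open>\<mu>1\<close> the first factor is a cosine, and \<open>\<mu>1\<close> is a Bernoulli convolution. If \<open>\<delta> = p / q < 1\<close>
  in lowest terms with \<open>p \<ge> 2\<close>, then \<open>char \<mu>1\<close> vanishes at infinity. The reason is arithmetic: were
  the whole orbit \<open>x, \<delta> x, \<delta>\<^sup>2 x, \<dots>\<close> close to integers \<open>N\<^sub>0, N\<^sub>1, \<dots>\<close> until it gets down to size \<open>R\<close>,
  then \<open>q N\<^sub>j\<^sub>+\<^sub>1 = p N\<^sub>j\<close> exactly, because both sides are integers at distance less than 1. So
  \<open>p\<^sup>n\<close> divides the last integer \<open>N\<^sub>n\<close>, whose size is of order \<open>R\<close>; this bounds \<open>n\<close> and hence \<open>x\<close>
  (lemma \<open>orbit_leaves_integers\<close>). Consequently every large argument meets, still at a large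
  scale, a cosine factor bounded by a fixed \<open>\<kappa> < 1\<close>, and this repeats (lemma
  \<open>cos_recursion_tendsto_zero\<close>). Both \<open>2 / 5\<close> and \<open>3 / 10\<close> are of this kind.

  For \<open>\<mu>2\<close> the first factor is \<open>char \<mu>1\<close>, which is eventually smaller than \<open>\<delta>\<^sup>2\<close>. Each division of \<open>t\<close>
  by \<open>\<delta>\<close> thus gains a factor \<open>\<delta>\<^sup>2\<close>, which is decay of order \<open>t\<^sup>-\<^sup>2\<close> (lemma
  \<open>vanishing_factor_recursion_quadratic_decay\<close>). So \<open>char \<mu>2\<close> is integrable, and Fourier inversion
  gives a bounded continuous density (lemma \<open>continuous_density_of_integrable_char\<close>). A bounded
  probability density is square integrable, which covers the second claim too.
\<close>

section \<open>Orbits of a rational contraction near the integers\<close>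

lemma abs_cos_pi_le_of_far_from_integers:
  fixes x \<eta> :: real
  assumes "0 \<le> \<eta>" and far: "\<And>m :: int. \<eta> \<le> \<bar>x - m\<bar>"
  shows "\<bar>cos (pi * x)\<bar> \<le> cos (pi * \<eta>)"
proof -
  define r where "r = x - round x"
  have r: "\<eta> \<le> \<bar>r\<bar>" "\<bar>r\<bar> \<le> 1 / 2"
    using far[of "round x"] of_int_round_abs_le[of x] by (auto simp: r_def abs_minus_commute)
  have s: "sin (pi * round x) = 0"
    by (metis mult.commute sin_zero_iff_int2)
  have "\<bar>cos (pi * round x)\<bar> = 1"
    using sin_cos_squared_add[of "pi * round x"] s by (simp add: power2_eq_1_iff)
  moreover have "cos (pi * x) = cos (pi * round x) * cos (pi * r)"
    using cos_add[of "pi * round x" "pi * r"] s by (simp add: r_def algebra_simps)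
  ultimately have "\<bar>cos (pi * x)\<bar> = \<bar>cos (pi * \<bar>r\<bar>)\<bar>"
    by (cases "r \<ge> 0") (auto simp: abs_mult)
  also have "\<dots> = cos (pi * \<bar>r\<bar>)"
  proof -
    have "pi * \<bar>r\<bar> \<le> pi * (1/2)" using r by (intro mult_left_mono) auto
    moreover have "0 \<le> pi * \<bar>r\<bar>" by simp
    ultimately show ?thesis by (intro abs_of_nonneg cos_ge_zero) linarith+
  qed
  also have "\<dots> \<le> cos (pi * \<eta>)"
    using r assms(1) by (intro cos_monotone_0_pi_le mult_left_mono) auto
  finally show ?thesis .
qed

text \<open>
  Coprimality turns a long stretch of orbit near the integers into divisibility of a small integer
  by a high power of \<open>p\<close>. This needs \<open>p \<ge> 2\<close>: for \<open>p = 1\<close> the orbit of \<open>q\<^sup>n\<close> runs through integers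
  all the way down to \<open>1\<close>. The distance \<open>1 / (p + q)\<close> is what makes \<open>\<bar>q N' - p N\<bar> < 1\<close> when \<open>N\<close>
  and \<open>N'\<close> are closer than that to consecutive orbit points.
\<close>

lemma orbit_leaves_integers:
  fixes p q :: int and R :: real
  assumes pq: "2 \<le> p" "p < q" "coprime p q" and R: "1 \<le> R"
  defines "\<delta> \<equiv> real_of_int p / real_of_int q"
  shows "\<exists>S. \<forall>x. S \<le> \<bar>x\<bar> \<longrightarrow>
           (\<exists>k. R \<le> \<bar>\<delta> ^ k * x\<bar> \<and> (\<forall>m :: int. 1 / real_of_int (p + q) \<le> \<bar>\<delta> ^ k * x - m\<bar>))"
proof -
  have \<delta>: "0 < \<delta>" "\<delta> < 1" using pq by (auto simp: \<delta>_def)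
  \<comment> \<open>No nonzero integer of size below \<open>R / \<delta> + 1\<close> is divisible by \<open>p ^ n\<close> with \<open>n \<ge> n0\<close>.\<close>
  obtain n0 where n0: "R / \<delta> + 1 < 2 ^ n0"
    using real_arch_pow[of 2 "R / \<delta> + 1"] by auto
  show ?thesis
  proof (rule exI[of _ "R / \<delta> ^ n0"], intro allI impI)
    fix x :: real assume x: "R / \<delta> ^ n0 \<le> \<bar>x\<bar>"
    have "(\<lambda>k. \<delta> ^ k * \<bar>x\<bar>) \<longlonglongrightarrow> 0 * \<bar>x\<bar>"
      using \<delta> by (intro tendsto_intros LIMSEQ_power_zero) auto
    then have "\<forall>\<^sub>F k in sequentially. \<delta> ^ k * \<bar>x\<bar> < R"
      using R by (intro order_tendstoD) auto
    then obtain k1 where "\<delta> ^ k1 * \<bar>x\<bar> < R"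
      by (auto dest: eventually_happens)
    \<comment> \<open>At time \<open>k - 1\<close> the orbit has size between \<open>R\<close> and \<open>R / \<delta>\<close>.\<close>
    then obtain k where k: "\<delta> ^ k * \<bar>x\<bar> < R" and min: "\<And>j. j < k \<Longrightarrow> R \<le> \<delta> ^ j * \<bar>x\<bar>"
      using exists_least_iff[of "\<lambda>k. \<delta> ^ k * \<bar>x\<bar> < R"] by (auto simp: not_less)
    have big: "R \<le> \<delta> ^ n0 * \<bar>x\<bar>" using x \<delta> by (simp add: field_simps)
    have "n0 < k"
    proof (rule ccontr)
      assume "\<not> n0 < k"
      then have "\<delta> ^ n0 * \<bar>x\<bar> \<le> \<delta> ^ k * \<bar>x\<bar>"
        using \<delta> by (intro mult_right_mono power_decreasing) auto
      then show False using big k by linarith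
    qed
    then obtain n where n: "k = Suc n" "n0 \<le> n" by (cases k) auto
    have large: "R \<le> \<bar>\<delta> ^ j * x\<bar>" if "j \<le> n" for j
      using min[of j] that n \<delta> by (simp add: abs_mult)
    show "\<exists>k. R \<le> \<bar>\<delta> ^ k * x\<bar> \<and> (\<forall>m :: int. 1 / real_of_int (p + q) \<le> \<bar>\<delta> ^ k * x - m\<bar>)"
    proof (rule ccontr)
      assume no: "\<not> ?thesis"
      have "\<exists>m :: int. \<bar>\<delta> ^ j * x - m\<bar> < 1 / real_of_int (p + q)" if "j \<le> n" for j
        using no large[OF that] by (meson not_le)
      then obtain N :: "nat \<Rightarrow> int" where
        N: "\<And>j. j \<le> n \<Longrightarrow> \<bar>\<delta> ^ j * x - N j\<bar> < 1 / real_of_int (p + q)" by metis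
      have step: "q * N (Suc j) = p * N j" if "j < n" for j
      proof -
        have e: "q * \<delta> ^ Suc j = p * \<delta> ^ j" using pq by (simp add: \<delta>_def)
        have "real_of_int (q * N (Suc j) - p * N j)
            = p * (\<delta> ^ j * x - N j) - q * (\<delta> ^ Suc j * x - N (Suc j))"
          using e by (simp add: algebra_simps del: power_Suc)
        also have "\<bar>\<dots>\<bar> \<le> p * \<bar>\<delta> ^ j * x - N j\<bar> + q * \<bar>\<delta> ^ Suc j * x - N (Suc j)\<bar>"
          using pq by (intro order_trans[OF abs_triangle_ineq4]) (simp add: abs_mult)
        also have "\<dots> < p * (1 / real_of_int (p + q)) + q * (1 / real_of_int (p + q))"
          using pq that N[of j] N[of "Suc j"] by (intro add_strict_mono mult_strict_left_mono) auto
        also have "\<dots> = 1" using pq by (simp add: add_divide_distrib[symmetric])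
        finally have "\<bar>q * N (Suc j) - p * N j\<bar> < 1" by linarith
        then show ?thesis by linarith
      qed
      have "q ^ j * N j = p ^ j * N 0" if "j \<le> n" for j
        using that
      proof (induction j)
        case (Suc j)
        then show ?case using step[of j]
          by (simp add: algebra_simps) (metis mult.assoc mult.commute)
      qed simp
      then have "p ^ n dvd q ^ n * N n" by (metis dvd_triv_left order_refl)
      moreover have "coprime (p ^ n) (q ^ n)" using pq by simp
      ultimately have dvd: "p ^ n dvd N n" by (simp add: coprime_dvd_mult_right_iff)
      have small: "1 / real_of_int (p + q) < 1" using pq by simp
      have "N n \<noteq> 0" using N[of n] large[of n] R small by auto
      then have "p ^ n \<le> \<bar>N n\<bar>" using dvd by (metis abs_le_D1 dvd_imp_le_int)
      moreover have "2 ^ n \<le> p ^ n" using pq by (intro power_mono) auto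
      moreover have "(2::int) ^ n0 \<le> 2 ^ n" using n by (intro power_increasing) auto
      ultimately have "2 ^ n0 \<le> \<bar>N n\<bar>" by linarith
      then have "2 ^ n0 \<le> \<bar>real_of_int (N n)\<bar>"
        by (metis of_int_abs of_int_le_iff of_int_numeral of_int_power)
      also have "\<dots> < \<delta> ^ n * \<bar>x\<bar> + 1"
      proof -
        have "\<delta> ^ n * \<bar>x\<bar> = \<bar>\<delta> ^ n * x\<bar>" using \<delta> by (simp add: abs_mult)
        then show ?thesis using N[of n] small by linarith
      qed
      also have "\<delta> ^ n * \<bar>x\<bar> < R / \<delta>" using k \<delta> by (simp add: n field_simps)
      finally show False using n0 by simp
    qed
  qed
qed

section \<open>Decay from functional equations\<close>

text \<open>
  After rescaling the argument so that the factor is \<open>cos (\<pi> x)\<close>, a bound for all large arguments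
  improves by a constant factor \<open>\<kappa> < 1\<close> for all still larger ones: the recursion carries the
  argument, without increase of the bound, to an orbit point away from the integers, and there the
  cosine contributes \<open>\<kappa>\<close>.
\<close>

lemma cos_recursion_tendsto_zero:
  fixes \<psi> :: "real \<Rightarrow> real" and p q :: int and c :: real
  assumes pq: "2 \<le> p" "p < q" "coprime p q" and c: "0 < c"
    and bounds: "\<And>x. 0 \<le> \<psi> x" "\<And>x. \<psi> x \<le> 1"
    and rec: "\<And>x. \<psi> x \<le> \<bar>cos (c * x)\<bar> * \<psi> (real_of_int p / real_of_int q * x)"
  shows "(\<psi> \<longlongrightarrow> 0) at_infinity"
proof -
  define \<delta> where "\<delta> = real_of_int p / real_of_int q"
  define \<kappa> where "\<kappa> = cos (pi * (1 / real_of_int (p + q)))"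
  define \<omega> where "\<omega> = (\<lambda>x. \<psi> (pi / c * x))"
  have \<delta>: "0 < \<delta>" "\<delta> < 1" using pq by (auto simp: \<delta>_def)
  have \<omega>_rec: "\<omega> x \<le> \<bar>cos (pi * x)\<bar> * \<omega> (\<delta> * x)" for x
    using rec[of "pi / c * x"] c by (simp add: \<omega>_def \<delta>_def mult_ac)
  have small: "1 / real_of_int (p + q) \<le> 1 / 5" using pq by (simp add: field_simps)
  have \<kappa>: "0 \<le> \<kappa>" "\<kappa> < 1"
  proof -
    have "pi * (1 / real_of_int (p + q)) \<le> pi * (1/5)"
      using small by (intro mult_left_mono) auto
    moreover have pos: "0 < pi * (1 / real_of_int (p + q))" using pq by simp
    ultimately show "0 \<le> \<kappa>" unfolding \<kappa>_def by (intro cos_ge_zero) linarith+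
    have "\<kappa> < cos 0" unfolding \<kappa>_def
      using pos \<open>pi * (1 / real_of_int (p + q)) \<le> pi * (1/5)\<close> by (intro cos_monotone_0_pi) linarith+
    then show "\<kappa> < 1" by simp
  qed
  have mono: "\<omega> x \<le> \<omega> (\<delta> ^ k * x)" for k x
  proof (induction k)
    case (Suc k)
    note Suc.IH
    also have "\<omega> (\<delta> ^ k * x) \<le> \<bar>cos (pi * (\<delta> ^ k * x))\<bar> * \<omega> (\<delta> * (\<delta> ^ k * x))"
      by (rule \<omega>_rec)
    also have "\<dots> \<le> 1 * \<omega> (\<delta> * (\<delta> ^ k * x))"
      using bounds(1) by (intro mult_right_mono) (auto simp: \<omega>_def)
    finally show ?case by (simp add: mult_ac)
  qed simp
  have decay: "\<exists>X. \<forall>x. X \<le> \<bar>x\<bar> \<longrightarrow> \<omega> x \<le> \<kappa> ^ n" for n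
  proof (induction n)
    case 0
    then show ?case using bounds by (simp add: \<omega>_def)
  next
    case (Suc n)
    then obtain X where X: "\<And>x. X \<le> \<bar>x\<bar> \<Longrightarrow> \<omega> x \<le> \<kappa> ^ n" by blast
    \<comment> \<open>The scale \<open>X / \<delta>\<close> leaves room for one more contraction after the cosine has been used.\<close>
    obtain S where S: "\<And>x. S \<le> \<bar>x\<bar> \<Longrightarrow> \<exists>k. max 1 (X / \<delta>) \<le> \<bar>\<delta> ^ k * x\<bar> \<and>
        (\<forall>m :: int. 1 / real_of_int (p + q) \<le> \<bar>\<delta> ^ k * x - m\<bar>)"
      using orbit_leaves_integers[OF pq, of "max 1 (X / \<delta>)"] unfolding \<delta>_def by auto
    have "\<omega> x \<le> \<kappa> ^ Suc n" if "S \<le> \<bar>x\<bar>" for x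
    proof -
      note Sx = S[OF that]
      obtain k where k: "max 1 (X / \<delta>) \<le> \<bar>\<delta> ^ k * x\<bar>"
        and far: "\<And>m :: int. 1 / real_of_int (p + q) \<le> \<bar>\<delta> ^ k * x - m\<bar>" using Sx by blast
      have "X / \<delta> \<le> \<bar>\<delta> ^ k * x\<bar>" using k by simp
      then have "X \<le> \<bar>\<delta> * (\<delta> ^ k * x)\<bar>"
        using \<delta> by (simp add: abs_mult field_simps)
      note X' = X[OF this]
      have cos: "\<bar>cos (pi * (\<delta> ^ k * x))\<bar> \<le> \<kappa>"
        unfolding \<kappa>_def using far pq by (intro abs_cos_pi_le_of_far_from_integers) auto
      have "\<omega> x \<le> \<omega> (\<delta> ^ k * x)" by (rule mono)
      also have "\<dots> \<le> \<bar>cos (pi * (\<delta> ^ k * x))\<bar> * \<omega> (\<delta> * (\<delta> ^ k * x))" by (rule \<omega>_rec)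
      also have "\<dots> \<le> \<kappa> * \<kappa> ^ n"
        using \<kappa> bounds(1) by (intro mult_mono cos X') (auto simp: \<omega>_def)
      finally show ?thesis by simp
    qed
    then show ?case by blast
  qed
  show ?thesis
  proof (rule tendstoI)
    fix \<epsilon> :: real assume "0 < \<epsilon>"
    then obtain n where n: "\<kappa> ^ n < \<epsilon>" using \<kappa> real_arch_pow_inv[of \<epsilon> \<kappa>] by blast
    obtain X where X: "\<And>x. X \<le> \<bar>x\<bar> \<Longrightarrow> \<omega> x \<le> \<kappa> ^ n" using decay[of n] by blast
    have "dist (\<psi> x) 0 < \<epsilon>" if "pi / c * X \<le> norm x" for x
    proof -
      have "X \<le> \<bar>c / pi * x\<bar>" using that c by (simp add: abs_mult field_simps)
      from X[OF this] have "\<psi> x \<le> \<kappa> ^ n" using c by (simp add: \<omega>_def)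
      then show ?thesis using n bounds(1)[of x] by (simp add: dist_real_def)
    qed
    then show "\<forall>\<^sub>F x in at_infinity. dist (\<psi> x) 0 < \<epsilon>"
      unfolding eventually_at_infinity by blast
  qed
qed

text \<open>
  Where \<open>f t \<le> \<delta>\<^sup>2\<close>, the recursion says that \<open>t\<^sup>2 \<psi> t\<close> does not exceed its own value at \<open>\<delta> t\<close>, so it is
  bounded by its supremum over a bounded interval. Comparing \<open>f\<close> with \<open>\<delta>\<^sup>m\<close> would give decay of order
  \<open>m\<close>; order 2 suffices for integrability.
\<close>

lemma vanishing_factor_recursion_quadratic_decay:
  fixes \<psi> f :: "real \<Rightarrow> real"
  assumes \<delta>: "0 < \<delta>" "\<delta> < 1"
    and bounds: "\<And>t. 0 \<le> \<psi> t" "\<And>t. \<psi> t \<le> 1"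
    and f: "(f \<longlongrightarrow> 0) at_infinity"
    and rec: "\<And>t. \<psi> t \<le> f t * \<psi> (\<delta> * t)"
  obtains C where "\<And>t. \<psi> t \<le> C * inverse (1 + t\<^sup>2)"
proof -
  have "\<forall>\<^sub>F t in at_infinity. f t < \<delta>\<^sup>2"
    using \<delta> by (intro order_tendstoD[OF f]) auto
  then obtain T0 where "\<forall>t. T0 \<le> norm t \<longrightarrow> f t < \<delta>\<^sup>2"
    unfolding eventually_at_infinity by blast
  then obtain T where T: "0 < T" "\<And>t. T \<le> \<bar>t\<bar> \<Longrightarrow> f t \<le> \<delta>\<^sup>2"
    by (metis max.bounded_iff max.cobounded2 less_max_iff_disj zero_less_one less_imp_le real_norm_def)
  have *: "t\<^sup>2 * \<psi> t \<le> T\<^sup>2" if "\<delta> ^ n * \<bar>t\<bar> \<le> T" for n t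
    using that
  proof (induction n arbitrary: t)
    case 0
    then have "\<bar>t\<bar>\<^sup>2 \<le> T\<^sup>2" by (intro power_mono) auto
    then show ?case using bounds[of t] mult_mono[of "t\<^sup>2" "T\<^sup>2" "\<psi> t" 1] by simp
  next
    case (Suc n)
    show ?case
    proof (cases "T \<le> \<bar>t\<bar>")
      case True
      have "t\<^sup>2 * \<psi> t \<le> t\<^sup>2 * (\<delta>\<^sup>2 * \<psi> (\<delta> * t))"
        using rec[of t] T(2)[OF True] bounds(1)[of "\<delta> * t"]
        by (intro mult_left_mono) (auto intro: order_trans mult_right_mono)
      also have "\<dots> = (\<delta> * t)\<^sup>2 * \<psi> (\<delta> * t)" by (simp add: power_mult_distrib)
      also have "\<dots> \<le> T\<^sup>2" using Suc \<delta> by (intro Suc.IH) (simp add: abs_mult mult_ac)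
      finally show ?thesis .
    next
      case False
      then have "\<bar>t\<bar>\<^sup>2 \<le> T\<^sup>2" by (intro power_mono) auto
      then show ?thesis using bounds[of t] mult_mono[of "t\<^sup>2" "T\<^sup>2" "\<psi> t" 1] by simp
    qed
  qed
  have "\<psi> t \<le> (1 + T\<^sup>2) * inverse (1 + t\<^sup>2)" for t
  proof -
    have "(\<lambda>n. \<delta> ^ n * \<bar>t\<bar>) \<longlonglongrightarrow> 0 * \<bar>t\<bar>"
      using \<delta> by (intro tendsto_intros LIMSEQ_power_zero) auto
    then have "\<forall>\<^sub>F n in sequentially. \<delta> ^ n * \<bar>t\<bar> < T"
      using T by (intro order_tendstoD) auto
    then obtain n where "\<delta> ^ n * \<bar>t\<bar> < T" by (auto dest: eventually_happens)
    then have "t\<^sup>2 * \<psi> t \<le> T\<^sup>2" by (intro *[of n]) simp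
    then have "(1 + t\<^sup>2) * \<psi> t \<le> 1 + T\<^sup>2" using bounds[of t] by (simp add: algebra_simps)
    then show ?thesis by (simp add: field_simps add_pos_nonneg)
  qed
  then show ?thesis by (rule that)
qed

section \<open>Characteristic functions of invariant measures\<close>

lemma prob_on_interval_real_distribution:
  "prob_on_interval M \<Longrightarrow> real_distribution M"
  by (simp add: prob_on_interval_def real_distribution_def real_distribution_axioms_def)

lemma prob_on_interval_set_integral:
  fixes f :: "real \<Rightarrow> real"
  assumes M: "prob_on_interval M" and f [measurable]: "f \<in> borel_measurable borel"
  shows "(LINT x:{-1..1}|M. f x) = (LINT x|M. f x)"
proof -
  interpret real_distribution M using M by (rule prob_on_interval_real_distribution)
  have "AE x in M. x \<in> {-1..1}"
    using M by (intro AE_in_set_eq_1[THEN iffD2]) (auto simp: prob_on_interval_def measure_def)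
  then show ?thesis
    unfolding set_lebesgue_integral_def
    by (intro integral_cong_AE) (auto simp: indicator_def)
qed

text \<open>
  The defining identity of an invariant measure, freed from the restriction to \<open>[-1, 1]\<close>: both
  measures have full mass there, so for a function that is continuous on the whole line the
  restricted integrals are ordinary ones.
\<close>

lemma invariant_measure_integral:
  fixes f :: "real \<Rightarrow> real"
  assumes \<sigma>: "prob_on_interval \<sigma>" and \<mu>: "invariant_measure \<delta> \<sigma> \<mu>"
    and f: "continuous_on UNIV f"
  shows "(LINT x|\<mu>. f x) = (LINT x|\<mu>. LINT \<beta>|\<sigma>. f (\<delta> * x + (1 - \<delta>) * \<beta>))"
proof -
  have \<mu>': "prob_on_interval \<mu>" using \<mu> by (simp add: invariant_measure_def)
  interpret \<sigma>: real_distribution \<sigma> using \<sigma> by (rule prob_on_interval_real_distribution)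
  interpret \<mu>: real_distribution \<mu> using \<mu>' by (rule prob_on_interval_real_distribution)
  have [measurable]: "f \<in> borel_measurable borel"
    using f by (rule borel_measurable_continuous_onI)
  have inner: "transfer \<delta> \<sigma> f x = (LINT \<beta>|\<sigma>. f (\<delta> * x + (1 - \<delta>) * \<beta>))" for x
    unfolding transfer_def ifs_map_eq using \<sigma> by (intro prob_on_interval_set_integral) auto
  have "(LINT x|\<mu>. f x) = (LINT x:{-1..1}|\<mu>. f x)"
    using \<mu>' by (intro prob_on_interval_set_integral[symmetric]) auto
  also have "\<dots> = (LINT x:{-1..1}|\<mu>. LINT \<beta>|\<sigma>. f (\<delta> * x + (1 - \<delta>) * \<beta>))"
    using \<mu> continuous_on_subset[OF f]
    by (auto simp: invariant_measure_def transfer_adjoint_def inner)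
  also have "\<dots> = (LINT x|\<mu>. LINT \<beta>|\<sigma>. f (\<delta> * x + (1 - \<delta>) * \<beta>))"
    using \<mu>' by (intro prob_on_interval_set_integral) measurable
  finally show ?thesis .
qed

text \<open>
  The characteristic function of a sum of independent variables is a product. Invariance is only
  given for real test functions, so it is applied to the cosine and the sine separately, and the
  product appears after they are put together again.
\<close>

lemma char_invariant_measure:
  assumes \<sigma>: "prob_on_interval \<sigma>" and \<mu>: "invariant_measure \<delta> \<sigma> \<mu>"
  shows "char \<mu> t = char \<sigma> ((1 - \<delta>) * t) * char \<mu> (\<delta> * t)"
proof -
  interpret \<sigma>: real_distribution \<sigma> using \<sigma> by (rule prob_on_interval_real_distribution)
  interpret \<mu>: real_distribution \<mu>
    using \<mu> by (intro prob_on_interval_real_distribution) (simp add: invariant_measure_def)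
  let ?e = "\<lambda>x \<beta>. iexp (t * (\<delta> * x + (1 - \<delta>) * \<beta>))"
  have int\<mu>: "integrable \<mu> (\<lambda>x. iexp (s * x))" for s
    by (rule \<mu>.integrable_const_bound[of _ 1]) auto
  have int\<sigma>: "integrable \<sigma> (\<lambda>\<beta>. ?e x \<beta>)" for x
    by (rule \<sigma>.integrable_const_bound[of _ 1]) auto
  have inner: "(CLINT \<beta>|\<sigma>. ?e x \<beta>) = iexp (\<delta> * t * x) * char \<sigma> ((1 - \<delta>) * t)" for x
  proof -
    have "?e x \<beta> = iexp (\<delta> * t * x) * iexp ((1 - \<delta>) * t * \<beta>)" for \<beta>
      by (simp add: exp_add[symmetric] algebra_simps)
    then show ?thesis by (simp add: char_def)
  qed
  have int: "integrable \<mu> (\<lambda>x. CLINT \<beta>|\<sigma>. ?e x \<beta>)"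
    unfolding inner by (intro integrable_mult_left int\<mu>)
  have "Re (char \<mu> t) = (LINT x|\<mu>. cos (t * x))"
    unfolding char_def using int\<mu> by (subst integral_Re[symmetric]) (auto simp: Re_exp)
  also have "\<dots> = (LINT x|\<mu>. LINT \<beta>|\<sigma>. cos (t * (\<delta> * x + (1 - \<delta>) * \<beta>)))"
    by (intro invariant_measure_integral[OF \<sigma> \<mu>] continuous_intros)
  also have "\<dots> = (LINT x|\<mu>. LINT \<beta>|\<sigma>. Re (?e x \<beta>))" by (simp add: Re_exp)
  also have "\<dots> = Re (CLINT x|\<mu>. CLINT \<beta>|\<sigma>. ?e x \<beta>)"
    using int by (simp only: integral_Re[OF int\<sigma>] integral_Re[OF int])
  finally have Re: "Re (char \<mu> t) = Re (CLINT x|\<mu>. CLINT \<beta>|\<sigma>. ?e x \<beta>)" .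
  have "Im (char \<mu> t) = (LINT x|\<mu>. sin (t * x))"
    unfolding char_def using int\<mu> by (subst integral_Im[symmetric]) (auto simp: Im_exp)
  also have "\<dots> = (LINT x|\<mu>. LINT \<beta>|\<sigma>. sin (t * (\<delta> * x + (1 - \<delta>) * \<beta>)))"
    by (intro invariant_measure_integral[OF \<sigma> \<mu>] continuous_intros)
  also have "\<dots> = (LINT x|\<mu>. LINT \<beta>|\<sigma>. Im (?e x \<beta>))" by (simp add: Im_exp)
  also have "\<dots> = Im (CLINT x|\<mu>. CLINT \<beta>|\<sigma>. ?e x \<beta>)"
    using int by (simp only: integral_Im[OF int\<sigma>] integral_Im[OF int])
  finally have "char \<mu> t = (CLINT x|\<mu>. CLINT \<beta>|\<sigma>. ?e x \<beta>)"
    using Re by (simp add: complex_eq_iff)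
  also have "\<dots> = (CLINT x|\<mu>. iexp (\<delta> * t * x)) * char \<sigma> ((1 - \<delta>) * t)"
    unfolding inner by simp
  finally show ?thesis by (simp add: char_def)
qed

lemma char_mu0: "char mu0 t = cos t"
proof -
  interpret real_distribution mu0 by (intro prob_on_interval_real_distribution prob_on_interval_mu0)
  have "(1 / 2 :: ennreal) = ennreal (1 / 2)" using divide_ennreal[of 1 2] by simp
  then have half: "enn2real (1 / 2) = 1 / 2" by (metis enn2real_ennreal zero_le_divide_1_iff zero_le_numeral)
  have m: "measure mu0 {1} = 1 / 2" "measure mu0 {-1} = 1 / 2"
    by (auto simp: measure_def emeasure_mu0 half)
  have "emeasure mu0 (- {-1, 1}) = 0"
    by (simp add: emeasure_mu0)
  then have AE: "AE x in mu0. x \<in> {-1, 1}"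
    by (intro AE_I[of _ _ "- {-1, 1}"]) (auto intro: borel_comp)
  have "char mu0 t = (CLINT x|mu0. indicator {1} x *\<^sub>R iexp t + indicator {-1} x *\<^sub>R iexp (-t))"
    unfolding char_def using AE
    by (intro integral_cong_AE) (auto elim!: eventually_mono)
  also have "\<dots> = (1 / 2) *\<^sub>R iexp t + (1 / 2) *\<^sub>R iexp (-t)"
  proof -
    have "integrable mu0 (indicator {a} :: real \<Rightarrow> real)" for a
      by (intro integrable_real_indicator) (auto simp: emeasure_eq_measure)
    then show ?thesis
      by (subst Bochner_Integration.integral_add)
         (auto simp: m integral_scaleR_left intro!: integrable_scaleR_left)
  qed
  also have "\<dots> = cos t"
    by (simp add: complex_eq_iff Re_exp Im_exp)
  finally show ?thesis .
qed

section \<open>Fourier inversion for integrable characteristic functions\<close>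

lemma LBINT_iexp_Ioc:
  fixes a b t :: real
  assumes "a \<le> b" "t \<noteq> 0"
  shows "(CLBINT x:{a<..b}. iexp (-(t * x))) = (iexp (-(t * a)) - iexp (-(t * b))) / (\<i> * t)"
proof -
  have "(CLBINT x=a..b. iexp (-(t * x))) = iexp (-(t * b)) / (-(\<i> * t)) - iexp (-(t * a)) / (-(\<i> * t))"
    using assms
    by (intro interval_integral_FTC_finite)
       (auto intro!: continuous_intros derivative_eq_intros simp: has_vector_derivative_complex_iff Re_exp Im_exp field_simps Re_divide Im_divide
         power2_eq_square power4_eq_xxxx)
  then show ?thesis using assms
    by (simp add: interval_integral_Ioc field_simps)
qed

text \<open>
  The candidate density is the inverse Fourier transform \<open>g\<close> of the characteristic function \<open>\<phi>\<close>. When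
  \<open>\<phi>\<close> is integrable, the principal value in Levy's inversion formula is a genuine integral and
  Fubini turns it into the integral of \<open>g\<close> over \<open>{a<..b}\<close>. Levy's formula is for endpoints that are
  not atoms, but boundedness of \<open>g\<close> then excludes atoms altogether. Nonnegativity of \<open>g\<close> is not
  visible from its definition; it follows since \<open>g\<close> is continuous and its integrals over intervals
  are probabilities.
\<close>

lemma (in real_distribution) continuous_density_of_integrable_char:
  assumes int: "complex_integrable lborel (char M)"
  obtains g :: "real \<Rightarrow> real" and B where "continuous_on UNIV g" "\<And>x. 0 \<le> g x" "\<And>x. g x \<le> B"
    "M = density lborel (\<lambda>x. ennreal (g x))"
proof -
  define \<phi> where "\<phi> = char M"
  define G where "G = (\<lambda>x. CLBINT t. iexp (-(t * x)) * \<phi> t)"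
  define g where "g = (\<lambda>x. Re (G x) / (2 * pi))"
  define B where "B = (LBINT t. cmod (\<phi> t)) / (2 * pi)"
  have [measurable]: "\<phi> \<in> borel_measurable borel" unfolding \<phi>_def by measurable
  have int\<phi>: "integrable lborel (\<lambda>t. cmod (\<phi> t))" using int by (simp add: \<phi>_def)
  have intG: "complex_integrable lborel (\<lambda>t. iexp (-(t * x)) * \<phi> t)" for x
    by (rule Bochner_Integration.integrable_bound[OF int\<phi>]) (auto simp: norm_mult simp del: of_real_minus of_real_mult)
  have contG: "continuous_on UNIV G"
    unfolding G_def continuous_on_eq_continuous_at[OF open_UNIV] continuous_at_sequentially comp_def
    by (intro ballI allI impI integral_dominated_convergence[OF _ _ int\<phi>])
       (auto intro!: tendsto_intros simp: norm_mult simp del: of_real_minus of_real_mult)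
  have contg: "continuous_on UNIV g"
    unfolding g_def by (intro continuous_intros contG) auto
  have [measurable]: "G \<in> borel_measurable borel" "g \<in> borel_measurable borel"
    using contG contg by (auto intro: borel_measurable_continuous_onI)
  have "cmod (G x) \<le> (LBINT t. cmod (\<phi> t))" for x
    unfolding G_def
    by (rule order_trans[OF integral_norm_bound]) (simp add: norm_mult del: of_real_minus of_real_mult)
  then have "\<bar>Re (G x)\<bar> \<le> (LBINT t. cmod (\<phi> t))" for x
    using abs_Re_le_cmod order_trans by blast
  then have gB: "\<bar>g x\<bar> \<le> B" for x
    by (simp add: g_def B_def divide_right_mono)
  have intg: "set_integrable lborel {a<..b} g" for a b
    unfolding set_integrable_def
    using gB by (intro integrableI_bounded_set_indicator[where B=B])
      (auto intro!: emeasure_bounded_finite[unfolded infinity_ennreal_def] bounded_subset[OF bounded_closed_interval[of a b]])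

  have inversion: "measure M {a<..b} = (LBINT x:{a<..b}. g x)"
    if ab: "a \<le> b" and null: "measure M {a} = 0" "measure M {b} = 0" for a b
  proof -
    let ?F = "\<lambda>t. (iexp (-(t * a)) - iexp (-(t * b))) / (\<i> * t)"
    \<comment> \<open>The value of \<open>?F\<close> at \<open>0\<close>, by the convention on division, is \<open>0\<close> and not the limit \<open>b - a\<close>;
      its identity with the integral of the exponential therefore holds only almost everywhere.\<close>
    have Fbound: "cmod (?F t) \<le> b - a" if "t \<noteq> 0" for t
      using Levy_Inversion_aux2[of "-b" "-a" t] ab that by (simp add: norm_minus_commute)
    have AE0: "AE t in lborel. t \<noteq> (0::real)"
      by (rule AE_I[of _ _ "{0}"]) auto
    have intF: "complex_integrable lborel (\<lambda>t. ?F t * \<phi> t)"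
    proof (rule Bochner_Integration.integrable_bound)
      show "integrable lborel (\<lambda>t. (b - a) * cmod (\<phi> t))" using int\<phi> by simp
      show "AE t in lborel. norm (?F t * \<phi> t) \<le> norm ((b - a) * cmod (\<phi> t))"
        using AE0
      proof eventually_elim
        case (elim t)
        have "norm (?F t * \<phi> t) \<le> (b - a) * cmod (\<phi> t)"
          unfolding norm_mult by (intro mult_right_mono Fbound elim norm_ge_zero)
        then show ?case using ab by simp
      qed
    qed measurable
    have "(\<lambda>n. CLBINT t. indicator {- real n<..<real n} t *\<^sub>R (?F t * \<phi> t)) \<longlonglongrightarrow> (CLBINT t. ?F t * \<phi> t)"
    proof (rule integral_dominated_convergence)
      show "integrable lborel (\<lambda>t. cmod (?F t * \<phi> t))" using intF by (rule integrable_norm)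
      have "(\<lambda>n. indicator {- real n<..<real n} t *\<^sub>R (?F t * \<phi> t)) \<longlonglongrightarrow> ?F t * \<phi> t" for t
      proof (rule tendsto_eventually)
        obtain N where "\<bar>t\<bar> < real N" using reals_Archimedean2 by blast
        then show "\<forall>\<^sub>F n in sequentially. indicator {- real n<..<real n} t *\<^sub>R (?F t * \<phi> t) = ?F t * \<phi> t"
          by (intro eventually_sequentiallyI[of N]) (auto simp: indicator_def)
      qed
      then show "AE t in lborel. (\<lambda>n. indicator {- real n<..<real n} t *\<^sub>R (?F t * \<phi> t)) \<longlonglongrightarrow> ?F t * \<phi> t"
        by simp
    qed (auto simp: indicator_def)
    then have "(\<lambda>n. 1 / (2 * pi) * (CLBINT t=-real n..real n. ?F t * \<phi> t))
        \<longlonglongrightarrow> 1 / (2 * pi) * (CLBINT t. ?F t * \<phi> t)"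
      by (intro tendsto_intros) (simp add: interval_lebesgue_integral_def set_lebesgue_integral_def)
    with Levy_Inversion[OF ab null, unfolded of_int_minus of_int_of_nat_eq] have
      M: "complex_of_real (measure M {a<..b}) = 1 / (2 * pi) * (CLBINT t. ?F t * \<phi> t)"
      unfolding \<phi>_def by (rule LIMSEQ_unique)
    let ?k = "\<lambda>t x. indicator {a<..b} x *\<^sub>R (iexp (-(t * x)) * \<phi> t)"
    have intk: "complex_integrable (lborel \<Otimes>\<^sub>M lborel) (\<lambda>(t, x). ?k t x)"
    proof (rule lborel_pair.Fubini_integrable)
      have "(LBINT x. norm (?k t x)) = (b - a) * cmod (\<phi> t)" for t
      proof -
        have "(LBINT x. norm (?k t x)) = (LBINT x. indicator {a<..b} x * cmod (\<phi> t))"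
          by (simp add: norm_mult del: of_real_minus of_real_mult)
        then show ?thesis using ab by simp
      qed
      then show "integrable lborel (\<lambda>t. LBINT x. norm (case (t, x) of (t, x) \<Rightarrow> ?k t x))"
        using int\<phi> by simp
      have "complex_integrable lborel (\<lambda>x. ?k t x)" for t
        by (intro integrableI_bounded_set_indicator[where B="cmod (\<phi> t)"])
           (auto simp: norm_mult ab simp del: of_real_minus of_real_mult)
      then show "AE t in lborel. complex_integrable lborel (\<lambda>x. case (t, x) of (t, x) \<Rightarrow> ?k t x)"
        by simp
    qed measurable
    have "(CLBINT t. ?F t * \<phi> t) = (CLBINT t. CLBINT x. ?k t x)"
    proof (rule integral_cong_AE)
      show "AE t in lborel. ?F t * \<phi> t = (CLBINT x. ?k t x)"
        using AE0
      proof eventually_elim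
        case (elim t)
        have "(CLBINT x. ?k t x) = (CLBINT x:{a<..b}. iexp (-(t * x))) * \<phi> t"
          unfolding set_lebesgue_integral_def
          by (simp flip: mult_scaleR_left del: of_real_minus of_real_mult)
        then show ?case using LBINT_iexp_Ioc[OF ab elim] by simp
      qed
    qed measurable
    also have "\<dots> = (CLBINT x. CLBINT t. ?k t x)"
      by (rule lborel_pair.Fubini_integral[symmetric, OF intk])
    also have "\<dots> = (CLBINT x:{a<..b}. G x)"
      by (simp add: G_def set_lebesgue_integral_def)
    finally have "measure M {a<..b} = Re (CLBINT x:{a<..b}. G x) / (2 * pi)"
      using arg_cong[OF M, of Re] by simp
    also have "Re (CLBINT x:{a<..b}. G x) = (LBINT x:{a<..b}. Re (G x))"
      unfolding set_lebesgue_integral_def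
      by (subst integral_Re[symmetric])
         (auto intro!: integrableI_bounded_set_indicator[where B="LBINT t. cmod (\<phi> t)"]
           simp: \<open>\<And>x. cmod (G x) \<le> _\<close> ab)
    finally show ?thesis by (simp add: g_def)
  qed

  have le: "(LBINT x:{a<..b}. g x) \<le> C * (b - a)"
    if "a \<le> b" "\<And>x. a < x \<Longrightarrow> x \<le> b \<Longrightarrow> g x \<le> C" for a b C
  proof -
    have "(LBINT x:{a<..b}. g x) \<le> (LBINT x:{a<..b}. C)"
      using that by (intro set_integral_mono intg) (auto simp: set_integrable_def)
    also have "\<dots> = C * (b - a)"
      using that by (simp add: set_lebesgue_integral_def)
    finally show ?thesis .
  qed

  have atomless: "measure M {x} = 0" for x
  proof -
    have "measure M {x} \<le> \<epsilon>" if "0 < \<epsilon>" for \<epsilon>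
    proof -
      define c where "c = \<bar>B\<bar> + 1"
      define r where "r = \<epsilon> / (2 * c)"
      have c: "0 < c" "\<bar>B\<bar> \<le> c" by (auto simp: c_def)
      have r: "0 < r" using that c by (simp add: r_def)
      \<comment> \<open>There are only countably many atoms, so endpoints near \<open>x\<close> can be chosen to avoid them.\<close>
      obtain a where a: "a \<in> {x - r<..<x}" "measure M {a} = 0"
        using open_minus_countable[OF countable_support, of "{x - r<..<x}"] r by auto
      obtain b where b: "b \<in> {x<..<x + r}" "measure M {b} = 0"
        using open_minus_countable[OF countable_support, of "{x<..<x + r}"] r by auto
      have "measure M {x} \<le> measure M {a<..b}" using a b by (intro finite_measure_mono) auto
      also have "\<dots> = (LBINT y:{a<..b}. g y)" using a b by (intro inversion) auto
      also have "\<dots> \<le> \<bar>B\<bar> * (b - a)"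
        using a b by (intro le order_trans[OF abs_ge_self order_trans[OF gB abs_ge_self]]) auto
      also have "\<dots> \<le> c * (2 * r)" using a b c by (intro mult_mono) auto
      also have "\<dots> = \<epsilon>"
        using c by (simp add: r_def)
      finally show ?thesis .
    qed
    then have "measure M {x} \<le> 0" by (rule dense_ge) simp
    then show ?thesis by (rule antisym) (rule measure_nonneg)
  qed

  have nonneg: "0 \<le> g x" for x
  proof (rule ccontr)
    assume "\<not> 0 \<le> g x"
    then have neg: "g x < 0" by simp
    have "isCont g x" using contg by (simp add: continuous_on_eq_continuous_at)
    have pos: "0 < - g x / 2" using neg by simp
    obtain d where d: "0 < d" "\<And>y. dist y x < d \<Longrightarrow> dist (g y) (g x) < - g x / 2"
      using continuous_at_eps_delta[THEN iffD1, rule_format, OF \<open>isCont g x\<close> pos]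
      by (auto simp: dist_real_def)
    have "g y \<le> g x / 2" if "x < y" "y \<le> x + d / 2" for y
      using d(2)[of y] that d(1) by (simp add: dist_real_def)
    then have "(LBINT y:{x<..x + d/2}. g y) \<le> g x / 2 * (x + d/2 - x)"
      using d(1) by (intro le) auto
    also have "\<dots> < 0" using d(1) neg by (simp add: mult_neg_pos)
    finally show False
      using inversion[of x "x + d/2"] d(1) atomless measure_nonneg[of M "{x<..x + d/2}"] by simp
  qed

  have "M = density lborel (\<lambda>x. ennreal (g x))"
  proof (rule measure_eqI_generator_eq[where \<Omega>=UNIV])
    fix X assume "X \<in> range (\<lambda>(a, b). {a<..b::real})"
    then obtain a b where X: "X = {a<..b}" by auto
    show "emeasure M X = emeasure (density lborel (\<lambda>x. ennreal (g x))) X"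
    proof (cases "a \<le> b")
      case True
      have "emeasure M X = ennreal (LBINT x:{a<..b}. g x)"
        by (simp add: X emeasure_eq_measure inversion[OF True] atomless)
      also have "\<dots> = (\<integral>\<^sup>+x. ennreal (indicator {a<..b} x *\<^sub>R g x) \<partial>lborel)"
        unfolding set_lebesgue_integral_def
        using intg[of a b] nonneg by (intro nn_integral_eq_integral[symmetric]) (auto simp: set_integrable_def)
      also have "\<dots> = emeasure (density lborel (\<lambda>x. ennreal (g x))) X"
        by (simp add: X emeasure_density) (auto intro!: nn_integral_cong simp: indicator_def)
      finally show ?thesis .
    qed (simp add: X)
  next
    show "(\<Union>i. {- real (i::nat)<..real i}) = UNIV" by (rule UN_Ioc_eq_UNIV)
  qed (auto simp: borel_sigma_sets_Ioc Int_stable_def)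
  moreover have "g x \<le> B" for x using gB[of x] by linarith
  ultimately show ?thesis using that contg nonneg by blast
qed

section \<open>Densities of invariant measures\<close>

lemma tendsto_char_invariant_measure_mu0:
  assumes pq: "2 \<le> p" "p < q" "coprime p q"
    and \<mu>: "invariant_measure (real_of_int p / real_of_int q) mu0 \<mu>"
  shows "(char \<mu> \<longlongrightarrow> 0) at_infinity"
proof -
  interpret real_distribution \<mu>
    using \<mu> by (intro prob_on_interval_real_distribution) (simp add: invariant_measure_def)
  have "((\<lambda>t. norm (char \<mu> t)) \<longlongrightarrow> 0) at_infinity"
  proof (rule cos_recursion_tendsto_zero[OF pq])
    show "0 < 1 - real_of_int p / real_of_int q" using pq by simp
    show "norm (char \<mu> t) \<le> \<bar>cos ((1 - real_of_int p / real_of_int q) * t)\<bar>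
        * norm (char \<mu> (real_of_int p / real_of_int q * t))" for t
      by (subst char_invariant_measure[OF prob_on_interval_mu0 \<mu>]) (simp add: char_mu0 norm_mult)
  qed (simp_all add: cmod_char_le_1)
  then show ?thesis by (rule tendsto_norm_zero_cancel)
qed

text \<open>
  Randomizing the fixed points smooths: any fixed-point law whose characteristic function vanishes
  at infinity will do, whatever the contraction ratio. A smaller \<open>\<delta>\<close> only means that one
  must go further out before \<open>char \<sigma>\<close> is below \<open>\<delta>\<^sup>2\<close>.
\<close>

lemma invariant_measure_continuous_density:
  assumes \<delta>: "0 < \<delta>" "\<delta> < 1"
    and \<sigma>: "prob_on_interval \<sigma>" and lim: "(char \<sigma> \<longlongrightarrow> 0) at_infinity"
    and \<mu>: "invariant_measure \<delta> \<sigma> \<mu>"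
  obtains g :: "real \<Rightarrow> real" and B where "continuous_on UNIV g" "\<And>x. 0 \<le> g x" "\<And>x. g x \<le> B"
    "\<mu> = density lborel (\<lambda>x. ennreal (g x))"
proof -
  interpret real_distribution \<mu>
    using \<mu> by (intro prob_on_interval_real_distribution) (simp add: invariant_measure_def)
  have "filterlim (\<lambda>t. (1 - \<delta>) * t) at_infinity at_infinity"
    using \<delta> by (intro tendsto_mult_filterlim_at_infinity[OF tendsto_const] filterlim_ident) auto
  then have lim': "((\<lambda>t. norm (char \<sigma> ((1 - \<delta>) * t))) \<longlongrightarrow> 0) at_infinity"
    by (intro tendsto_norm_zero filterlim_compose[OF lim])
  have rec: "norm (char \<mu> t) \<le> norm (char \<sigma> ((1 - \<delta>) * t)) * norm (char \<mu> (\<delta> * t))" for t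
    by (subst char_invariant_measure[OF \<sigma> \<mu>]) (simp add: norm_mult)
  obtain C where C: "\<And>t. norm (char \<mu> t) \<le> C * inverse (1 + t\<^sup>2)"
    using vanishing_factor_recursion_quadratic_decay[OF \<delta> norm_ge_zero cmod_char_le_1 lim' rec]
    by blast
  have "complex_integrable lborel (char \<mu>)"
  proof (rule Bochner_Integration.integrable_bound)
    show "integrable lborel (\<lambda>t :: real. C * inverse (1 + t\<^sup>2))"
      using integrable_inverse_1_plus_square by (simp add: set_integrable_def)
    show "AE t in lborel. norm (char \<mu> t) \<le> norm (C * inverse (1 + t\<^sup>2))"
      using order_trans[OF C abs_ge_self] by simp
  qed simp
  then show ?thesis
    by (rule continuous_density_of_integrable_char) (rule that)
qed

lemma integrable_square_of_bounded_density:
  fixes g :: "real \<Rightarrow> real"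
  assumes "prob_space (density N (\<lambda>x. ennreal (g x)))"
    and [measurable]: "g \<in> borel_measurable N"
    and g: "\<And>x. 0 \<le> g x" "\<And>x. g x \<le> B"
  shows "integrable N (\<lambda>x. (g x)\<^sup>2)"
proof -
  interpret prob_space "density N (\<lambda>x. ennreal (g x))" by fact
  have "(\<integral>\<^sup>+x. ennreal (g x) \<partial>N) = 1"
    using emeasure_space_1 by (simp add: emeasure_density cong: nn_integral_cong)
  then have "integrable N g" using g by (intro integrableI_nonneg) auto
  then have "integrable N (\<lambda>x. B * g x)" by simp
  then show ?thesis
    by (rule Bochner_Integration.integrable_bound)
       (use g in \<open>auto simp: power2_eq_square intro!: mult_right_mono order_trans[OF _ abs_ge_self] AE_I2\<close>)
qed

theorem theorem4:
  fixes \<delta> :: real and \<mu>1 \<mu>2 :: "real measure"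
  assumes "0 < \<delta>" and "\<delta> < 1"
    and "invariant_measure \<delta> mu0 \<mu>1"
    and "invariant_measure \<delta> \<mu>1 \<mu>2"
  shows "(\<delta> = 2 / 5 \<longrightarrow>
            absolutely_continuous lborel \<mu>2 \<and>
            (\<exists>g :: real \<Rightarrow> real. continuous_on UNIV g \<and> (\<forall>x. 0 \<le> g x) \<and>
               \<mu>2 = density lborel (\<lambda>x. ennreal (g x)))) \<and>
         (\<delta> = 3 / 10 \<longrightarrow>
            absolutely_continuous lborel \<mu>2 \<and>
            (\<exists>g :: real \<Rightarrow> real. g \<in> borel_measurable lborel \<and> (\<forall>x. 0 \<le> g x) \<and>
               integrable lborel (\<lambda>x. (g x)\<^sup>2) \<and>
               \<mu>2 = density lborel (\<lambda>x. ennreal (g x))))"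
proof -
  have \<mu>1: "prob_on_interval \<mu>1" and \<mu>2: "prob_on_interval \<mu>2"
    using assms by (simp_all add: invariant_measure_def)
  have dens: "\<exists>g B. continuous_on UNIV g \<and> (\<forall>x. 0 \<le> g x) \<and> (\<forall>x. g x \<le> B) \<and>
      \<mu>2 = density lborel (\<lambda>x. ennreal (g x))"
    if "2 \<le> p" "p < q" "coprime p q" "\<delta> = real_of_int p / real_of_int q" for p q :: int
  proof -
    have "(char \<mu>1 \<longlongrightarrow> 0) at_infinity"
      using that assms(3) by (intro tendsto_char_invariant_measure_mu0) auto
    then show ?thesis
      using invariant_measure_continuous_density[OF assms(1,2) \<mu>1 _ assms(4)] by metis
  qed
  have ac: "absolutely_continuous lborel \<mu>2"
    if "\<mu>2 = density lborel (\<lambda>x. ennreal (g x))" "continuous_on UNIV g" for g :: "real \<Rightarrow> real"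
    unfolding that(1) using borel_measurable_continuous_onI[OF that(2)]
    by (intro absolutely_continuousI_density) simp
  show ?thesis
  proof (intro conjI impI)
    assume "\<delta> = 2 / 5"
    moreover have "coprime (2::int) 5" by (simp add: coprime_iff_gcd_eq_1 gcd_non_0_int)
    ultimately obtain g where g: "continuous_on UNIV g" "\<forall>x. 0 \<le> g x"
      "\<mu>2 = density lborel (\<lambda>x. ennreal (g x))"
      using dens[of 2 5] by auto
    then show "absolutely_continuous lborel \<mu>2" by (intro ac)
    show "\<exists>g. continuous_on UNIV g \<and> (\<forall>x. 0 \<le> g x) \<and> \<mu>2 = density lborel (\<lambda>x. ennreal (g x))"
      using g by blast
  next
    assume "\<delta> = 3 / 10"
    moreover have "coprime (3::int) 10" by (simp add: coprime_iff_gcd_eq_1 gcd_non_0_int)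
    ultimately obtain g B where g: "continuous_on UNIV g" "\<forall>x. 0 \<le> g x" "\<forall>x. g x \<le> B"
      "\<mu>2 = density lborel (\<lambda>x. ennreal (g x))"
      using dens[of 3 10] by auto
    then show "absolutely_continuous lborel \<mu>2" by (intro ac)
    have "g \<in> borel_measurable lborel"
      using borel_measurable_continuous_onI[OF g(1)] by simp
    moreover from this have "integrable lborel (\<lambda>x. (g x)\<^sup>2)"
      using \<mu>2 g by (intro integrable_square_of_bounded_density) (auto simp: prob_on_interval_def)
    ultimately show "\<exists>g. g \<in> borel_measurable lborel \<and> (\<forall>x. 0 \<le> g x) \<and>
        integrable lborel (\<lambda>x. (g x)\<^sup>2) \<and> \<mu>2 = density lborel (\<lambda>x. ennreal (g x))"
      using g by blast
  qed
qed

end
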